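(* Let $\{\mathcal{M}_k\}_{k=1}^L$ be a sequentially nested model family such that for every $k\in\{1,\dots,L\}$ the class of loss functions $\mathcal{L}_k=\{l(\cdot,\boldsymbol\theta_k):\boldsymbol\theta_k\in\mathcal{H}_k\}$ is Glivenko–Cantelli, let $K$ be the index of its most parsimonious model containing a global risk minimizer, and let $$\hat K=\max\{k\in\{1,\dots,L\}:T_k=1\},$$ where $T_1=1$ and, for $k\in\{2,\dots,L\}$, $T_k=\mathbb{I}\{R_{emp}(S_n,\hat{\boldsymbol\theta}_{k-1})-R_{emp}(S_n,\hat{\boldsymbol\theta}_k)\ge\gamma_k(n,\delta,S_n)\}$. Then for every $0<\delta<1/(L-K+1)$ there is a positive integer $N$ such that for every $n\ge N$, $$\mathbb{P}\{\hat K=K\}\ge1-(L-K+1)\delta .$$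
   Context: Setting: $S_n=(\mathbf{z}_1,\dots,\mathbf{z}_n)$ consists of $n$ i.i.d. copies of a random element $\mathbf{Z}$ with unknown distribution $\mathcal{P}$ (on $\mathcal{X}\subset\mathbb{R}^p$ with $\mathbf{z}=\mathbf{x}$ in the unsupervised case, or on $\mathcal{X}\times\mathcal{Y}$, $\mathcal{Y}\subset\mathbb{R}^q$, with $\mathbf{z}=(\mathbf{x},\mathbf{y})$ in the supervised case). A model $\mathcal{M}_k=\{f_{\boldsymbol\theta_k}:\boldsymbol\theta_k\in\mathcal{H}_k\}$ is a set of functions (probability densities or conditional densities / predictors) with parameter space $\mathcal{H}_k$. The nonnegative loss $l(\mathbf{z},\boldsymbol\theta)$ stands for $l(f_{\boldsymbol\theta}(\mathbf{x}))$ or $l(f_{\boldsymbol\theta}(\mathbf{x}),\mathbf{y})$, so it depends on $\boldsymbol\theta$ only through $f_{\boldsymbol\theta}$. The risk is $R(\boldsymbol\theta)=\mathbb{E}\{l(\mathbf{Z},\boldsymbol\theta)\}$ and the empirical risk is $R_{emp}(S_n,\boldsymbol\theta)=\frac1n\sum_{i=1}^n l(\mathbf{z}_i,\boldsymbol\theta)$. For each model, $\boldsymbol\theta_k^*\in\arg\min_{\boldsymbol\theta_k\in\mathcal{H}_k}R(\boldsymbol\theta_k)$ and $\hat{\boldsymbol\theta}_k\in\arg\min_{\boldsymbol\theta_k\in\mathcal{H}_k}R_{emp}(S_n,\boldsymbol\theta_k)$ (minimizers are assumed to exist). Glivenko–Cantelli: a class $\mathcal{F}$ is Glivenko–Cantelli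 for the distribution of $\mathbf{Z}$ if for every $\varepsilon>0$, $\lim_{n\to\infty}\mathbb{P}\{\sup_{f\in\mathcal{F}}|\frac1n\sum_{i=1}^n f(\mathbf{z}_i)-\mathbb{E}\{f(\mathbf{Z})\}|>\varepsilon\}=0$. Nested: $\mathcal{M}_i$ is nested in $\mathcal{M}_j$ if for all $\boldsymbol\theta_i\in\mathcal{H}_i$ there is $\boldsymbol\theta_j\in\mathcal{H}_j$ (not necessarily equal to $\boldsymbol\theta_i$) with $f_{\boldsymbol\theta_i}=f_{\boldsymbol\theta_j}$ (pointwise equality everywhere). A model class $\{\mathcal{M}_k\}_{k=1}^L$, $L>2$, is sequentially nested if $\mathcal{M}_i$ is nested in $\mathcal{M}_j$ for all $1\le i\le j\le L$. Index $K$: a global risk minimizer $f_{\boldsymbol\theta^*}$ is a function in $\bigcup_k\mathcal{M}_k$ of minimum risk over all models of the class; $K$ is the index such that $\mathcal{M}_K$ contains a global risk minimizer and either $K=1$ or $\mathcal{M}_{K-1}$ contains none. $\mathcal{M}_K$ is called the most parsimonious model containing a global risk minimizer. Thresholds: for $k\in\{2,\dots,L\}$, $\gamma_k(n,\delta,S_n)$ is a fixed deterministic function (despite $S_n$ in the notation) of order $o(1)$, i.e. for every fixed $\delta\in(0,1]$ and $\varepsilon>0$ there is $n_0$ with $\gamma_k(n,\delta,S_n)\le\varepsilon$ for $n\ge n_0$, and such that for some positive integer $N_k'$, for all $n\ge N_k'$ and $0<\delta\le1$, $\mathbb{P}\{|R_{emp}(S_n,\hat{\boldsymbol\theta}_{k-1})-R_{emp}(S_n,\hat{\boldsymbol\theta}_k)-R(\boldsymbol\theta_{k-1}^*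 )+R(\boldsymbol\theta_k^* )|\le\gamma_k(n,\delta,S_n)\}\ge1-\delta$. $\mathbb{I}$ denotes the indicator function. Remark on ties: the paper treats the borderline event of equality between the difference of empirical risks and $\gamma_k$ as having no effect on the probability bounds.
   Formalization: It is additionally assumed that, for each k≥2, n≥N'_k and δ in (0,1], the difference of empirical risks equals γ_k with probability zero (ties are null events); without this the claim fails, e.g. for identical models with γ_k=0. *)

theory Defs
  imports "HOL-Probability.Probability"
begin

(* An observation z determines its covariate inp z: inp = id for z = x and inp = fst for
   z = (x, y).  A model function g sends a covariate x to a value g x, which may itself be a
   function (a conditional density) or a vector (a predictor).  The loss incurred by g at z is
   loss z (g (inp z)); this has both l(g(x)) and l(g(x), y) as instances and depends on a
   parameter only through its function. *)

definition risk ::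
    "'z measure \<Rightarrow> ('z \<Rightarrow> 'x) \<Rightarrow> ('z \<Rightarrow> 'v \<Rightarrow> real) \<Rightarrow> ('x \<Rightarrow> 'v) \<Rightarrow> real" where
  "risk P inp loss g = (\<integral>z. loss z (g (inp z)) \<partial>P)"

(* The sample of size n consists of the first n terms s 0, ..., s (n - 1) of s. *)
definition emp_risk ::
    "('z \<Rightarrow> 'x) \<Rightarrow> ('z \<Rightarrow> 'v \<Rightarrow> real) \<Rightarrow> nat \<Rightarrow> (nat \<Rightarrow> 'z) \<Rightarrow> ('x \<Rightarrow> 'v) \<Rightarrow> real" where
  "emp_risk inp loss n s g = (\<Sum>i<n. loss (s i) (g (inp (s i)))) / real n"

definition iid_sample :: "'w measure \<Rightarrow> 'z measure \<Rightarrow> (nat \<Rightarrow> 'w \<Rightarrow> 'z) \<Rightarrow> bool" where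
  "iid_sample M P Z \<longleftrightarrow>
     prob_space M \<and> prob_space.indep_vars M (\<lambda>_. P) Z UNIV \<and> (\<forall>i. distr M P (Z i) = P)"

(* Outer probability is used because a supremum over an uncountable class need not be
   measurable; on measurable events it is the ordinary probability.  The supremum is taken in
   the extended reals, so it may be infinite. *)
definition glivenko_cantelli ::
    "'w measure \<Rightarrow> 'z measure \<Rightarrow> (nat \<Rightarrow> 'w \<Rightarrow> 'z) \<Rightarrow> ('z \<Rightarrow> real) set \<Rightarrow> bool" where
  "glivenko_cantelli M P Z F \<longleftrightarrow>
     (\<forall>h\<in>F. integrable P h) \<and>
     (\<forall>\<epsilon>>0. (\<lambda>n. outer_measure_of M
        {\<omega> \<in> space M.
           (SUP h\<in>F. ennreal \<bar>(\<Sum>i<n. h (Z i \<omega>)) / real n - (\<integral>z. h z \<partial>P)\<bar>) > ennreal \<epsilon>})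
        \<longlonglongrightarrow> 0)"

(* The k-th model is the set f k ` H k of functions on X.  The parameter spaces H k are
   subsets of one ambient type; they may overlap, so f also takes the model index. *)
definition nested ::
    "'x set \<Rightarrow> (nat \<Rightarrow> 'p \<Rightarrow> 'x \<Rightarrow> 'v) \<Rightarrow> (nat \<Rightarrow> 'p set) \<Rightarrow> nat \<Rightarrow> nat \<Rightarrow> bool" where
  "nested X f H i j \<longleftrightarrow> (\<forall>\<theta>\<in>H i. \<exists>\<theta>'\<in>H j. \<forall>x\<in>X. f i \<theta> x = f j \<theta>' x)"

definition sequentially_nested ::
    "'x set \<Rightarrow> (nat \<Rightarrow> 'p \<Rightarrow> 'x \<Rightarrow> 'v) \<Rightarrow> (nat \<Rightarrow> 'p set) \<Rightarrow> nat \<Rightarrow> bool" where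
  "sequentially_nested X f H L \<longleftrightarrow> (\<forall>i j. 1 \<le> i \<and> i \<le> j \<and> j \<le> L \<longrightarrow> nested X f H i j)"

definition global_risk_minimizer ::
    "'z measure \<Rightarrow> ('z \<Rightarrow> 'x) \<Rightarrow> ('z \<Rightarrow> 'v \<Rightarrow> real) \<Rightarrow>
     (nat \<Rightarrow> 'p \<Rightarrow> 'x \<Rightarrow> 'v) \<Rightarrow> (nat \<Rightarrow> 'p set) \<Rightarrow> nat \<Rightarrow> ('x \<Rightarrow> 'v) \<Rightarrow> bool" where
  "global_risk_minimizer P inp loss f H L =
     is_arg_min (risk P inp loss) (\<lambda>g. g \<in> (\<Union>k\<in>{1..L}. f k ` H k))"

definition most_parsimonious_index ::
    "'z measure \<Rightarrow> ('z \<Rightarrow> 'x) \<Rightarrow> ('z \<Rightarrow> 'v \<Rightarrow> real) \<Rightarrow>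
     (nat \<Rightarrow> 'p \<Rightarrow> 'x \<Rightarrow> 'v) \<Rightarrow> (nat \<Rightarrow> 'p set) \<Rightarrow> nat \<Rightarrow> nat \<Rightarrow> bool" where
  "most_parsimonious_index P inp loss f H L K \<longleftrightarrow>
     K \<in> {1..L} \<and>
     (\<exists>g\<in>f K ` H K. global_risk_minimizer P inp loss f H L g) \<and>
     (K = 1 \<or> \<not> (\<exists>g\<in>f (K - 1) ` H (K - 1). global_risk_minimizer P inp loss f H L g))"

(* Here r k stands for the minimal empirical risk of model k and c k for the threshold of the
   step from model k - 1 to model k. *)
definition step_indicator :: "(nat \<Rightarrow> real) \<Rightarrow> (nat \<Rightarrow> real) \<Rightarrow> nat \<Rightarrow> nat" where
  "step_indicator r c k = (if k = 1 then 1 else of_bool (r (k - 1) - r k \<ge> c k))"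

definition selected_index :: "nat \<Rightarrow> (nat \<Rightarrow> real) \<Rightarrow> (nat \<Rightarrow> real) \<Rightarrow> nat" where
  "selected_index L r c = Max {k \<in> {1..L}. step_indicator r c k = 1}"

end

(* With M_K containing a global minimizer, nestedness makes the minimal risk constant from K on
   and leaves a gap d > 0 between K - 1 and K.  On the coverage event of a step k > K the drop of the
   empirical risk is at most the threshold, and almost surely not equal to it, so the step is
   rejected; on the coverage event of the step K the drop is at least d minus the threshold, which
   is at least the threshold once the latter is at most d/2.  A union bound over the L - K + 1 steps
   K, ..., L concludes. *)
theory Submission
  imports Defs
begin

text \<open>Step 1 always passes, so the maximum runs over a finite nonempty set, and it is attained
  at \<open>K\<close> exactly when \<open>K\<close> passes and nothing later does. Outcomes of steps
  before \<open>K\<close> leave it unchanged, which is why the union bound only has to cover the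
  steps from \<open>K\<close> to \<open>L\<close>.\<close>

lemma selected_index_eq_iff:
  assumes "K \<in> {1..L}"
  shows "selected_index L r c = K \<longleftrightarrow>
    (K = 1 \<or> c K \<le> r (K - 1) - r K) \<and> (\<forall>k\<in>{K<..L}. r (k - 1) - r k < c k)"
proof -
  let ?S = "{k \<in> {1..L}. step_indicator r c k = 1}"
  have "1 \<in> ?S" using assms by (auto simp: step_indicator_def)
  then have "Max ?S = K \<longleftrightarrow> K \<in> ?S \<and> (\<forall>k\<in>?S. k \<le> K)"
    by (intro Max_eq_iff) auto
  also have "\<dots> \<longleftrightarrow> (K = 1 \<or> c K \<le> r (K - 1) - r K) \<and> (\<forall>k\<in>{K<..L}. r (k - 1) - r k < c k)"
  proof -
    have "K \<in> ?S \<longleftrightarrow> K = 1 \<or> c K \<le> r (K - 1) - r K"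
      using assms by (auto simp: step_indicator_def)
    moreover have "{K<..L} = {k \<in> {1..L}. \<not> k \<le> K}"
      using assms by auto
    then have "(\<forall>k\<in>?S. k \<le> K) \<longleftrightarrow> (\<forall>k\<in>{K<..L}. step_indicator r c k \<noteq> 1)"
      by blast
    moreover have "step_indicator r c k \<noteq> 1 \<longleftrightarrow> r (k - 1) - r k < c k" if "k \<in> {K<..L}" for k
      using assms that by (auto simp: step_indicator_def)
    ultimately show ?thesis by simp
  qed
  finally show ?thesis by (simp add: selected_index_def)
qed

text \<open>Nestedness equates model functions only on \<open>X\<close>, so risks are compared
  through the values at \<open>inp z\<close> and not through equality of functions.\<close>

lemma risk_cong:
  assumes "\<And>z. z \<in> space P \<Longrightarrow> g (inp z) = h (inp z)"
  shows "risk P inp loss g = risk P inp loss h"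
  unfolding risk_def by (rule Bochner_Integration.integral_cong) (simp_all add: assms)

text \<open>Model \<open>j\<close> contains a function that agrees on \<open>X\<close> with
  \<open>f i \<theta>\<close> and so has the same risk; a risk minimizer over \<open>H j\<close>
  does at least as well.\<close>

lemma nested_min_risk_le:
  assumes "nested X f H i j" and "\<And>z. z \<in> space P \<Longrightarrow> inp z \<in> X"
    and "\<theta> \<in> H i"
    and "is_arg_min (\<lambda>\<theta>. risk P inp loss (f j \<theta>)) (\<lambda>\<theta>. \<theta> \<in> H j) \<theta>'"
  shows "risk P inp loss (f j \<theta>') \<le> risk P inp loss (f i \<theta>)"
proof -
  obtain \<eta> where \<eta>: "\<eta> \<in> H j" "\<forall>x\<in>X. f i \<theta> x = f j \<eta> x"
    using assms(1,3) unfolding nested_def by blast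
  have "risk P inp loss (f j \<theta>') \<le> risk P inp loss (f j \<eta>)"
    using assms(4) \<eta>(1) by (simp add: is_arg_min_linorder)
  also have "\<dots> = risk P inp loss (f i \<theta>)"
    using \<eta>(2) assms(2) by (intro risk_cong) auto
  finally show ?thesis .
qed

lemma most_parsimonious_index_step_risk:
  assumes K: "most_parsimonious_index P inp loss f H L K"
    and nested: "sequentially_nested X f H L"
    and inp: "\<And>z. z \<in> space P \<Longrightarrow> inp z \<in> X"
    and min: "\<And>k. k \<in> {1..L} \<Longrightarrow>
      is_arg_min (\<lambda>\<theta>. risk P inp loss (f k \<theta>)) (\<lambda>\<theta>. \<theta> \<in> H k) (\<theta>star k)"
  shows "k \<in> {K<..L} \<Longrightarrow>
      risk P inp loss (f (k - 1) (\<theta>star (k - 1))) = risk P inp loss (f k (\<theta>star k))"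
    and "K \<noteq> 1 \<Longrightarrow>
      risk P inp loss (f K (\<theta>star K)) < risk P inp loss (f (K - 1) (\<theta>star (K - 1)))"
proof -
  let ?R = "\<lambda>k. risk P inp loss (f k (\<theta>star k))"
  have KL: "K \<in> {1..L}" using K by (simp add: most_parsimonious_index_def)
  have in_H: "\<theta>star k \<in> H k" if "k \<in> {1..L}" for k
    using min[OF that] by (simp add: is_arg_min_def)
  obtain \<theta> where \<theta>: "\<theta> \<in> H K" "global_risk_minimizer P inp loss f H L (f K \<theta>)"
    using K by (auto simp: most_parsimonious_index_def)
  have global: "risk P inp loss (f K \<theta>) \<le> risk P inp loss g"
    if "g \<in> (\<Union>k\<in>{1..L}. f k ` H k)" for g
    using \<theta>(2) that unfolding global_risk_minimizer_def is_arg_min_linorder by blast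
  \<comment> \<open>Nestedness of model \<open>K\<close> in model \<open>k\<close> bounds the
    minimal risk from above, global minimality of \<open>f K \<theta>\<close> from below. The range
    includes \<open>K\<close> itself because the step from \<open>K\<close> to \<open>K + 1\<close>
    compares with it.\<close>
  have const: "?R k = risk P inp loss (f K \<theta>)" if k: "k \<in> {K..L}" for k
  proof (rule antisym)
    show "?R k \<le> risk P inp loss (f K \<theta>)"
      using nested k KL \<theta>(1) inp min unfolding sequentially_nested_def
      by (intro nested_min_risk_le[of X f H K k]) auto
    show "risk P inp loss (f K \<theta>) \<le> ?R k"
      using k KL in_H[of k] by (intro global) auto
  qed
  show "?R (k - 1) = ?R k" if "k \<in> {K<..L}"
  proof -
    have "k \<in> {K..L}" "k - 1 \<in> {K..L}" using that by auto
    then show ?thesis using const by metis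
  qed
  show "?R K < ?R (K - 1)" if "K \<noteq> 1"
  proof -
    have K1: "K - 1 \<in> {1..L}" using KL that by auto
    \<comment> \<open>A member of the union that is not a global minimizer must be strictly beaten
      by another member; this is the source of the strict gap.\<close>
    then have mem: "f (K - 1) (\<theta>star (K - 1)) \<in> (\<Union>k\<in>{1..L}. f k ` H k)"
      using in_H by blast
    have "\<not> global_risk_minimizer P inp loss f H L (f (K - 1) (\<theta>star (K - 1)))"
      using K that in_H[OF K1] by (auto simp: most_parsimonious_index_def)
    then obtain g where "g \<in> (\<Union>k\<in>{1..L}. f k ` H k)" "risk P inp loss g < ?R (K - 1)"
      using mem unfolding global_risk_minimizer_def is_arg_min_def by blast
    with global[of g] const[of K] KL show ?thesis by auto
  qed
qed

theorem theorem3: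
  fixes M :: "'w measure"
    and P :: "'z::euclidean_space measure"
    and D :: "'z set"
    and X :: "'x::euclidean_space set"
    and inp :: "'z \<Rightarrow> 'x"
    and Z :: "nat \<Rightarrow> 'w \<Rightarrow> 'z"
    and loss :: "'z \<Rightarrow> 'v \<Rightarrow> real"
    and f :: "nat \<Rightarrow> 'p \<Rightarrow> 'x \<Rightarrow> 'v"
    and H :: "nat \<Rightarrow> 'p set"
    and \<theta>star :: "nat \<Rightarrow> 'p"
    and \<theta>hat :: "nat \<Rightarrow> nat \<Rightarrow> 'w \<Rightarrow> 'p"
    and r :: "nat \<Rightarrow> 'w \<Rightarrow> nat \<Rightarrow> real"
    and \<gamma> :: "nat \<Rightarrow> nat \<Rightarrow> real \<Rightarrow> real"
    and N' :: "nat \<Rightarrow> nat"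
    and L K :: nat
    and \<delta> :: real
  assumes L: "L > 2"
    and P_sets: "sets P = sets (restrict_space borel D)"
    and inp: "\<And>z. z \<in> D \<Longrightarrow> inp z \<in> X"
    and iid: "iid_sample M P Z"
    and loss_nonneg: "\<And>k \<theta> z. k \<in> {1..L} \<Longrightarrow> \<theta> \<in> H k \<Longrightarrow> z \<in> D \<Longrightarrow> 0 \<le> loss z (f k \<theta> (inp z))"
    and nested: "sequentially_nested X f H L"
    and GC: "\<And>k. k \<in> {1..L} \<Longrightarrow>
      glivenko_cantelli M P Z ((\<lambda>\<theta> z. loss z (f k \<theta> (inp z))) ` H k)"
    and \<theta>star: "\<And>k. k \<in> {1..L} \<Longrightarrow>
      is_arg_min (\<lambda>\<theta>. risk P inp loss (f k \<theta>)) (\<lambda>\<theta>. \<theta> \<in> H k) (\<theta>star k)"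
    and \<theta>hat: "\<And>k n \<omega>. k \<in> {1..L} \<Longrightarrow> n \<ge> 1 \<Longrightarrow> \<omega> \<in> space M \<Longrightarrow>
      is_arg_min (\<lambda>\<theta>. emp_risk inp loss n (\<lambda>i. Z i \<omega>) (f k \<theta>)) (\<lambda>\<theta>. \<theta> \<in> H k) (\<theta>hat k n \<omega>)"
    and r_def: "\<And>n \<omega> k. r n \<omega> k = emp_risk inp loss n (\<lambda>i. Z i \<omega>) (f k (\<theta>hat k n \<omega>))"
    and r_measurable: "\<And>k n. k \<in> {1..L} \<Longrightarrow> n \<ge> 1 \<Longrightarrow> (\<lambda>\<omega>. r n \<omega> k) \<in> borel_measurable M"
    and K: "most_parsimonious_index P inp loss f H L K"
    and \<gamma>_small: "\<And>k \<delta>' \<epsilon>. k \<in> {2..L} \<Longrightarrow> 0 < \<delta>' \<Longrightarrow> \<delta>' \<le> 1 \<Longrightarrow> \<epsilon> > 0 \<Longrightarrow>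
      \<exists>n0. \<forall>n\<ge>n0. \<gamma> k n \<delta>' \<le> \<epsilon>"
    and N'_pos: "\<And>k. k \<in> {2..L} \<Longrightarrow> N' k > 0"
    and \<gamma>_coverage: "\<And>k n \<delta>'. k \<in> {2..L} \<Longrightarrow> n \<ge> N' k \<Longrightarrow> 0 < \<delta>' \<Longrightarrow> \<delta>' \<le> 1 \<Longrightarrow>
      measure M {\<omega> \<in> space M.
        \<bar>r n \<omega> (k - 1) - r n \<omega> k
          - risk P inp loss (f (k - 1) (\<theta>star (k - 1))) + risk P inp loss (f k (\<theta>star k))\<bar>
        \<le> \<gamma> k n \<delta>'} \<ge> 1 - \<delta>'"
    and no_ties: "\<And>k n \<delta>'. k \<in> {2..L} \<Longrightarrow> n \<ge> N' k \<Longrightarrow> 0 < \<delta>' \<Longrightarrow> \<delta>' \<le> 1 \<Longrightarrow>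
      measure M {\<omega> \<in> space M. r n \<omega> (k - 1) - r n \<omega> k = \<gamma> k n \<delta>'} = 0"
    and \<delta>: "0 < \<delta>" "\<delta> < 1 / (real L - real K + 1)"
  shows "\<exists>N>0. \<forall>n\<ge>N.
    measure M {\<omega> \<in> space M. selected_index L (r n \<omega>) (\<lambda>k. \<gamma> k n \<delta>) = K}
      \<ge> 1 - (real L - real K + 1) * \<delta>"
proof -
  interpret prob_space M using iid by (simp add: iid_sample_def)
  let ?R = "\<lambda>k. risk P inp loss (f k (\<theta>star k))"
  let ?d = "\<lambda>n \<omega> k. r n \<omega> (k - 1) - r n \<omega> k"
  have KL: "K \<in> {1..L}" using K by (simp add: most_parsimonious_index_def)
  \<comment> \<open>Since K \<le> L, the denominator is at least 1; hence \<delta> \<le> 1, as the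
    assumptions on the thresholds require.\<close>
  have "1 / (real L - real K + 1) \<le> 1" using KL by simp
  then have \<delta>1: "\<delta> \<le> 1" using \<delta>(2) by linarith
  have "space P = D"
    using sets_eq_imp_space_eq[OF P_sets] by (simp add: space_restrict_space)
  then have inpX: "\<And>z. z \<in> space P \<Longrightarrow> inp z \<in> X" using inp by simp
  note step_risk = most_parsimonious_index_step_risk[OF K nested inpX \<theta>star]
  \<comment> \<open>The gap is positive, so half of it is an admissible \<epsilon> in
    \<open>\<gamma>_small\<close>. If \<open>K = 1\<close>, step 1 passes by definition and any
    \<open>n0\<close> serves.\<close>
  obtain n0 where n0: "K \<noteq> 1 \<Longrightarrow> n \<ge> n0 \<Longrightarrow> \<gamma> K n \<delta> \<le> (?R (K - 1) - ?R K) / 2" for n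
  proof (cases "K = 1")
    case False
    then show ?thesis
      using \<gamma>_small[of K \<delta> "(?R (K - 1) - ?R K) / 2"] step_risk(2) KL \<delta>(1) \<delta>1 that by auto
  qed (use that in blast)
  \<comment> \<open>The entry 1 makes \<open>N\<close> positive and keeps the sample nonempty, as
    measurability of \<open>r\<close> demands.\<close>
  define N where "N = Max (insert 1 (insert n0 (N' ` {2..L})))"
  have N: "1 \<le> N" "n0 \<le> N" "\<And>k. k \<in> {2..L} \<Longrightarrow> N' k \<le> N"
    unfolding N_def by (rule Max_ge; auto)+
  have "1 - (real L - real K + 1) * \<delta>
      \<le> prob {\<omega> \<in> space M. selected_index L (r n \<omega>) (\<lambda>k. \<gamma> k n \<delta>) = K}" if "N \<le> n" for n
  proof -
    have n: "1 \<le> n" "n0 \<le> n" "\<And>k. k \<in> {2..L} \<Longrightarrow> N' k \<le> n"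
      using N that by (auto intro: order_trans)
    have d_meas: "(\<lambda>\<omega>. ?d n \<omega> k) \<in> borel_measurable M" if "k \<in> {2..L}" for k
      using that by (intro borel_measurable_diff r_measurable n(1)) auto
    define C where "C k = {\<omega> \<in> space M. \<bar>?d n \<omega> k - ?R (k - 1) + ?R k\<bar> \<le> \<gamma> k n \<delta>}" for k
    define T where "T k = {\<omega> \<in> space M. ?d n \<omega> k = \<gamma> k n \<delta>}" for k
    \<comment> \<open>\<open>B k\<close> is the event that step \<open>k\<close> errs: a false
      rejection at \<open>K\<close>, a false acceptance later. Step 1 cannot err, so its event is
      empty; this treats \<open>K = 1\<close> uniformly and avoids the index 0.\<close>
    define B where "B k = (if k = 1 then {} else if k = K then {\<omega> \<in> space M. ?d n \<omega> k < \<gamma> k n \<delta>}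
      else {\<omega> \<in> space M. \<gamma> k n \<delta> \<le> ?d n \<omega> k})" for k
    have B_sets: "B k \<in> events" if "k \<in> {K..L}" for k
    proof (cases "k = 1")
      case False
      then have [measurable]: "(\<lambda>\<omega>. ?d n \<omega> k) \<in> borel_measurable M"
        using d_meas[of k] that KL by auto
      have "{\<omega> \<in> space M. ?d n \<omega> k < \<gamma> k n \<delta>} \<in> events"
        and "{\<omega> \<in> space M. \<gamma> k n \<delta> \<le> ?d n \<omega> k} \<in> events"
        by measurable
      then show ?thesis unfolding B_def by (simp only: sets.empty_sets split: if_split) blast
    qed (simp add: B_def)
    have B_prob: "prob (B k) \<le> \<delta>" if k: "k \<in> {K..L}" for k
    proof (cases "k = 1")
      case True
      then show ?thesis using \<delta>(1) by (simp add: B_def)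
    next
      case False
      then have k2: "k \<in> {2..L}" using k KL by auto
      have [measurable]: "(\<lambda>\<omega>. ?d n \<omega> k) \<in> borel_measurable M" by (rule d_meas[OF k2])
      have C_sets: "C k \<in> events" and T_sets: "T k \<in> events"
        unfolding C_def T_def by measurable
      have "1 - \<delta> \<le> prob (C k)"
        unfolding C_def using \<gamma>_coverage[OF k2 n(3)[OF k2] \<delta>(1) \<delta>1] .
      then have compl: "prob (space M - C k) \<le> \<delta>"
        using prob_compl[OF C_sets] by simp
      have null: "prob (T k) = 0"
        unfolding T_def using no_ties[OF k2 n(3)[OF k2] \<delta>(1) \<delta>1] .
      have "B k \<subseteq> (space M - C k) \<union> T k"
      proof (cases "k = K")
        case True
        \<comment> \<open>On \<open>C K\<close> the drop is at least the gap minus the threshold,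
          hence at least the threshold by the choice of \<open>n0\<close>, which excludes
          \<open>B K\<close>.\<close>
        then show ?thesis using n0[of n] n(2) False by (auto simp: B_def C_def abs_le_iff)
      next
        case False
        then have "?R (k - 1) = ?R k" using k by (intro step_risk(1)) auto
        \<comment> \<open>The two minimal risks cancel, so \<open>C k\<close> bounds the drop above
          by the threshold while \<open>B k\<close> bounds it below: their intersection lies in the
          tie event \<open>T k\<close>.\<close>
        with False show ?thesis by (auto simp: B_def C_def T_def abs_le_iff)
      qed
      then have "prob (B k) \<le> prob ((space M - C k) \<union> T k)"
        using C_sets T_sets by (intro finite_measure_mono) auto
      also have "\<dots> \<le> prob (space M - C k) + prob (T k)"
        using C_sets T_sets by (intro measure_Un_le) auto
      finally show ?thesis using compl null by simp
    qed
    \<comment> \<open>Correct selection is exactly the absence of errors, which also shows that this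
      event is measurable.\<close>
    have eq: "{\<omega> \<in> space M. selected_index L (r n \<omega>) (\<lambda>k. \<gamma> k n \<delta>) = K}
        = space M - (\<Union>k\<in>{K..L}. B k)"
    proof -
      have B_late: "B k = {\<omega> \<in> space M. \<gamma> k n \<delta> \<le> ?d n \<omega> k}" if "k \<in> {K<..L}" for k
        using that KL by (auto simp: B_def)
      have "{K..L} = insert K {K<..L}" using KL by auto
      then have "(\<Union>k\<in>{K..L}. B k)
          = B K \<union> (\<Union>k\<in>{K<..L}. {\<omega> \<in> space M. \<gamma> k n \<delta> \<le> ?d n \<omega> k})"
        using B_late by simp
      then show ?thesis
        unfolding selected_index_eq_iff[OF KL] by (auto simp: B_def not_le not_less)
    qed
    \<comment> \<open>All steps use the same sample, so the errors may be dependent; subadditivity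
      suffices.\<close>
    have "prob (\<Union>k\<in>{K..L}. B k) \<le> (\<Sum>k\<in>{K..L}. prob (B k))"
      using B_sets by (intro finite_measure_subadditive_finite) auto
    also have "\<dots> \<le> (\<Sum>k\<in>{K..L}. \<delta>)" by (intro sum_mono B_prob)
    also have "\<dots> = (real L - real K + 1) * \<delta>" using KL by (simp add: of_nat_diff Suc_diff_le)
    finally show ?thesis
      unfolding eq using B_sets by (subst prob_compl) auto
  qed
  then show ?thesis using N(1) by (intro exI[of _ N]) auto
qed

end
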